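(* Let $1 \leq l \leq q$ and $k \geq 0$ be integers. For $(z,t) \in \Omega \times B_{q^{q^k}}$ we have \[ \mathcal{G}_{l,k}(z,t) = (-1)^{l+1}\,\mathcal{G}_{1,k}(z,t)^l . \]
   Context: Let $q=p^e$ be a power of a prime $p$, $A=\mathbb{F}_q[\theta]$, $A_+$ the monic polynomials in $A$, $K=\mathbb{F}_q(\theta)$, $|\cdot|$ the absolute value with $|a|=q^{\deg_\theta a}$ for $a\in A$, $K_\infty$ the completion of $K$, and $\mathbb{C}_\infty$ the completion of an algebraic closure of $K_\infty$. Let $\Omega=\mathbb{C}_\infty\setminus K_\infty$ (Drinfeld upper half-plane) and $B_r=\{t\in\mathbb{C}_\infty: |t|<r\}$. For a lattice $\Lambda$ let $e_\Lambda(\zeta)=\zeta\prod_{0\neq\lambda\in\Lambda}(1-\zeta/\lambda)$. Fix $\tilde{\pi}\in\mathbb{C}_\infty$ such that $\tilde\pi A$ is the lattice of the Carlitz module ($\theta\mapsto \theta+\tau$); $e_{\tilde\pi A}$ is the Carlitz exponential. For $z\in\Omega$ let $\Lambda_z=zA\oplus A$. Put $s_{Car}(t)=\sum_{n\ge0} e_{\tilde\pi A}(\tilde\pi/\theta^{n+1})t^n$, $s_1(z,t)=\sum_{n\ge0}e_{\Lambda_z}(z/\theta^{n+1})t^n$, $s_2(z,t)=\sum_{n\ge0}e_{\Lambda_z}(1/\theta^{n+1})t^n$ (convergent for $|t|<q$), and $d_i=\tilde\pi\, s_{Car}^{-1} s_i$ for $i=1,2$; $d_1,d_2$ extend to functions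 defined for all $z\in\Omega$, $t\in\mathbb{C}_\infty$. For $a\in A$ write $a(t)$ for the polynomial $a$ evaluated at $\theta=t$. For positive integers $\alpha,\beta$ let $L(\chi_t^\alpha,\beta)=\sum_{a\in A_+} a(t)^\alpha a^{-\beta}$. For $l\ge1$, $k\ge 0$ define \[ \mathcal{G}_{l,k}(z,t)=\frac{1}{L(\chi_t^l, lq^k)}\sum_{(c,d)\in A^2\setminus\{(0,0)\}}\left(\frac{c(t)\,d_1(z,t)+d(t)\,d_2(z,t)}{(cz+d)^{q^k}}\right)^l, \] which is well defined for $(z,t)\in\Omega\times B_{q^{q^k}}$. *)

theory Defs
  imports "HOL-Analysis.Analysis" "HOL-Computational_Algebra.Computational_Algebra"
begin

text \<open>
  There is no concrete model of \<open>\<complex>\<^sub>\<infinity>\<close> in the libraries. It is described here, up to isometric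
  isomorphism, as an algebraically closed, complete, ultrametrically valued field containing
  \<open>\<theta>\<close>; all results are stated for an arbitrary such field. The smaller fields
  \<open>\<F>\<^sub>q \<subseteq> K \<subseteq> K\<^sub>\<infinity>\<close> are subsets of it.
\<close>

definition av :: "'c::{zero,metric_space} \<Rightarrow> real" where
  "av x = dist x 0"

text \<open>In an algebraically closed field of characteristic \<open>p\<close> and for \<open>q = p ^ e\<close>, the roots of
  \<open>X ^ q - X\<close> form the unique subfield with \<open>q\<close> elements.\<close>

definition Fq :: "nat \<Rightarrow> 'c::field set" where
  "Fq q = {x. x ^ q = x}"

text \<open>
  The ring \<open>A = \<F>\<^sub>q[\<theta>]\<close>, with its elements represented as polynomials over \<open>\<F>\<^sub>q\<close>: the element
  of the field is \<open>poly a \<theta>\<close> (\<open>\<theta>\<close> is transcendental over \<open>\<F>\<^sub>q\<close> because \<open>\<bar>\<theta>\<bar> = q > 1\<close>), and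
  \<open>a(t)\<close> is \<open>poly a t\<close>.
\<close>

definition A_ring :: "nat \<Rightarrow> 'c::field poly set" where
  "A_ring q = {a. \<forall>i. coeff a i \<in> Fq q}"

definition A_plus :: "nat \<Rightarrow> 'c::field poly set" where
  "A_plus q = {a \<in> A_ring q. lead_coeff a = 1}"

definition K_frac :: "nat \<Rightarrow> 'c::field \<Rightarrow> 'c set" where
  "K_frac q \<theta> = {poly a \<theta> / poly b \<theta> | a b. a \<in> A_ring q \<and> b \<in> A_ring q \<and> b \<noteq> 0}"

text \<open>As the ambient field is complete, the completion of \<open>K\<close> is its closure.\<close>

definition K_inf :: "nat \<Rightarrow> 'c::{field,metric_space} \<Rightarrow> 'c set" where
  "K_inf q \<theta> = closure (K_frac q \<theta>)"

definition algebraic_over :: "'c::field set \<Rightarrow> 'c \<Rightarrow> bool" where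
  "algebraic_over F x \<longleftrightarrow> (\<exists>f. f \<noteq> 0 \<and> (\<forall>i. coeff f i \<in> F) \<and> poly f x = 0)"

text \<open>
  The type \<open>'c\<close> with its metric is a model of \<open>\<complex>\<^sub>\<infinity>\<close>. The normalisation \<open>\<bar>\<theta>\<bar> = q\<close> forces
  \<open>\<bar>a\<bar> = q ^ degree a\<close> on \<open>A\<close>, since nonzero elements of \<open>\<F>\<^sub>q\<close> are roots of unity and so have
  absolute value 1. The elements algebraic over \<open>K\<^sub>\<infinity>\<close> form an algebraic closure
  of \<open>K\<^sub>\<infinity>\<close>, and by the last axiom its completion is the whole field.
\<close>

locale C_infinity =
  fixes p e q :: nat and \<theta> :: "'c::{alg_closed_field,complete_space}"
  assumes prime_p: "prime p"
    and e_pos: "e \<ge> 1"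
    and q_eq: "q = p ^ e"
    and char_p: "CHAR('c) = p"
    and dist_eq_av: "\<And>x y :: 'c. dist x y = av (x - y)"
    and av_mult: "\<And>x y :: 'c. av (x * y) = av x * av y"
    and av_ultrametric: "\<And>x y :: 'c. av (x + y) \<le> max (av x) (av y)"
    and av_theta: "av \<theta> = real q"
    and dense_algebraic: "closure {x. algebraic_over (K_inf q \<theta>) x} = UNIV"

definition Omega :: "nat \<Rightarrow> 'c::{field,metric_space} \<Rightarrow> 'c set" where
  "Omega q \<theta> = UNIV - K_inf q \<theta>"

definition B_disc :: "real \<Rightarrow> 'c::{zero,metric_space} set" where
  "B_disc r = {t. av t < r}"

text \<open>The infinite product is the limit of the net of finite partial products.\<close>

definition e_lattice :: "'c::{field,metric_space} set \<Rightarrow> 'c \<Rightarrow> 'c" where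
  "e_lattice \<Lambda> \<zeta> =
     \<zeta> * Lim (finite_subsets_at_top (\<Lambda> - {0})) (\<lambda>F. \<Prod>x\<in>F. 1 - \<zeta> / x)"

definition Carlitz_lattice :: "nat \<Rightarrow> 'c::field \<Rightarrow> 'c \<Rightarrow> 'c set" where
  "Carlitz_lattice q \<theta> \<pi> = {\<pi> * poly a \<theta> | a. a \<in> A_ring q}"

definition Lambda :: "nat \<Rightarrow> 'c::field \<Rightarrow> 'c \<Rightarrow> 'c set" where
  "Lambda q \<theta> z = {z * poly a \<theta> + poly b \<theta> | a b. a \<in> A_ring q \<and> b \<in> A_ring q}"

text \<open>
  The Drinfeld module \<open>\<phi>\<close> of a lattice \<open>\<Lambda>\<close> is determined by
  \<open>e\<^sub>\<Lambda>(\<theta>\<zeta>) = \<phi>\<^sub>\<theta>(e\<^sub>\<Lambda>(\<zeta>))\<close>; for the Carlitz module \<open>\<phi>\<^sub>\<theta> = \<theta> + \<tau>\<close>, where \<open>\<tau>\<close> is the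
  \<open>q\<close>-power map.
\<close>

definition Carlitz_period :: "nat \<Rightarrow> 'c::{field,metric_space} \<Rightarrow> 'c \<Rightarrow> bool" where
  "Carlitz_period q \<theta> \<pi> \<longleftrightarrow> \<pi> \<noteq> 0 \<and>
     (\<forall>\<zeta>. e_lattice (Carlitz_lattice q \<theta> \<pi>) (\<theta> * \<zeta>) =
          \<theta> * e_lattice (Carlitz_lattice q \<theta> \<pi>) \<zeta> + e_lattice (Carlitz_lattice q \<theta> \<pi>) \<zeta> ^ q)"

definition s_Car :: "nat \<Rightarrow> 'c::{field,metric_space} \<Rightarrow> 'c \<Rightarrow> 'c \<Rightarrow> 'c" where
  "s_Car q \<theta> \<pi> t = (\<Sum>n. e_lattice (Carlitz_lattice q \<theta> \<pi>) (\<pi> / \<theta> ^ (n + 1)) * t ^ n)"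

definition s1 :: "nat \<Rightarrow> 'c::{field,metric_space} \<Rightarrow> 'c \<Rightarrow> 'c \<Rightarrow> 'c" where
  "s1 q \<theta> z t = (\<Sum>n. e_lattice (Lambda q \<theta> z) (z / \<theta> ^ (n + 1)) * t ^ n)"

definition s2 :: "nat \<Rightarrow> 'c::{field,metric_space} \<Rightarrow> 'c \<Rightarrow> 'c \<Rightarrow> 'c" where
  "s2 q \<theta> z t = (\<Sum>n. e_lattice (Lambda q \<theta> z) (1 / \<theta> ^ (n + 1)) * t ^ n)"

definition entire :: "('c::{field,metric_space} \<Rightarrow> 'c) \<Rightarrow> bool" where
  "entire f \<longleftrightarrow> (\<exists>a. \<forall>t. (\<lambda>n. a n * t ^ n) sums f t)"

text \<open>
  The entire function extending \<open>f\<close> from the disc of radius \<open>r > 0\<close>; it is unique because a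
  convergent power series is determined by its values near 0.
\<close>

definition entire_extension ::
    "real \<Rightarrow> ('c::{field,metric_space} \<Rightarrow> 'c) \<Rightarrow> 'c \<Rightarrow> 'c" where
  "entire_extension r f = (THE g. entire g \<and> (\<forall>t\<in>B_disc r. g t = f t))"

definition d1 :: "nat \<Rightarrow> 'c::{field,metric_space} \<Rightarrow> 'c \<Rightarrow> 'c \<Rightarrow> 'c \<Rightarrow> 'c" where
  "d1 q \<theta> \<pi> z = entire_extension (real q) (\<lambda>t. \<pi> * inverse (s_Car q \<theta> \<pi> t) * s1 q \<theta> z t)"

definition d2 :: "nat \<Rightarrow> 'c::{field,metric_space} \<Rightarrow> 'c \<Rightarrow> 'c \<Rightarrow> 'c \<Rightarrow> 'c" where
  "d2 q \<theta> \<pi> z = entire_extension (real q) (\<lambda>t. \<pi> * inverse (s_Car q \<theta> \<pi> t) * s2 q \<theta> z t)"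

text \<open>\<open>L_chi q \<theta> \<alpha> \<beta> t\<close> is \<open>L(\<chi>\<^sub>t ^ \<alpha>, \<beta>)\<close>.\<close>

definition L_chi :: "nat \<Rightarrow> 'c::{field,metric_space} \<Rightarrow> nat \<Rightarrow> nat \<Rightarrow> 'c \<Rightarrow> 'c" where
  "L_chi q \<theta> \<alpha> \<beta> t = (\<Sum>\<^sub>\<infinity>a\<in>A_plus q. poly a t ^ \<alpha> / poly a \<theta> ^ \<beta>)"

definition G_series ::
    "nat \<Rightarrow> 'c::{field,metric_space} \<Rightarrow> 'c \<Rightarrow> nat \<Rightarrow> nat \<Rightarrow> 'c \<Rightarrow> 'c \<Rightarrow> 'c" where
  "G_series q \<theta> \<pi> l k z t =
     1 / L_chi q \<theta> l (l * q ^ k) t *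
     (\<Sum>\<^sub>\<infinity>(c, d)\<in>A_ring q \<times> A_ring q - {(0, 0)}.
        ((poly c t * d1 q \<theta> \<pi> z t + poly d t * d2 q \<theta> \<pi> z t) /
         (poly c \<theta> * z + poly d \<theta>) ^ (q ^ k)) ^ l)"

end

theory Submission
  imports Defs
begin

text \<open>
  For fixed \<open>t\<close>, the map \<open>cz + d \<mapsto> c(t) d\<^sub>1 + d(t) d\<^sub>2\<close> is \<open>\<F>\<^sub>q\<close>-linear on \<open>\<Lambda>\<^sub>z\<close>, and nothing
  else about the numerators matters. Let \<open>V\<close> be a finite \<open>\<F>\<^sub>q\<close>-subspace of a field and \<open>f\<close> a
  linear map on \<open>V\<close>. Then \<open>f\<close> is given on \<open>V\<close> by an \<open>\<F>\<^sub>q\<close>-linear polynomial of degree at most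
  \<open>card V / q\<close>, with linear coefficient \<open>b\<close>, say. For \<open>1 \<le> l \<le> q\<close> the polynomial \<open>(f v / v) ^ l\<close>
  has degree less than \<open>card V - 1\<close>, hence its values on \<open>V\<close> sum to 0, and so
  \<open>\<Sum>v\<noteq>0. (f v / v) ^ l = - b ^ l\<close>. As \<open>q ^ k\<close>-th powers are additive, extracting \<open>q ^ k\<close>-th roots of
  the values of \<open>f\<close> gives the same shape for \<open>f v / v ^ (q ^ k)\<close>. Letting \<open>V\<close> exhaust
  \<open>\<Lambda>\<^sub>z\<close> and \<open>A\<close> respectively, we get \<open>S\<^sub>l = (-1) ^ (l + 1) * S\<^sub>1 ^ l\<close> for the lattice sums and
  \<open>L(\<chi>\<^sub>t ^ l, l q ^ k) = L(\<chi>\<^sub>t, q ^ k) ^ l\<close>; the latter needs no sign because \<open>A - {0}\<close> consists of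
  the \<open>q - 1 = -1\<close> scalar multiples of the monic polynomials.
\<close>

subsection \<open>Power sums over finite vector spaces\<close>

text \<open>Lagrange interpolation with a common denominator: since V is closed under differences,
  the product of v - u over the u in V other than v is the same constant \<open>c\<close> for every
  v. Hence \<open>L\<close> and \<open>smult c S\<close> agree at all points of V and have degree
  below \<open>card V\<close>, so they coincide. Comparing coefficients at \<open>card V - 1\<close>
  gives the sum of the values of S on one side and 0 on the other.\<close>

lemma sum_poly_additive_subgroup:
  fixes V :: "'c::field set"
  assumes fin: "finite V" and diff: "\<And>u v. u \<in> V \<Longrightarrow> v \<in> V \<Longrightarrow> u - v \<in> V"
    and deg: "degree S + 1 < card V"
  shows "(\<Sum>v\<in>V. poly S v) = 0"
proof -
  define m where "m = card V - 1"
  define c where "c = (\<Prod>u\<in>V - {0}. u)"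
  define M where "M = (\<lambda>v. \<Prod>u\<in>V - {v}. [:- u, 1:])"
  define L where "L = (\<Sum>v\<in>V. smult (poly S v) (M v))"
  have c0: "c \<noteq> 0" unfolding c_def using fin by simp
  have "V \<noteq> {}" using deg by auto
  then obtain v0 where "v0 \<in> V" by auto
  then have zero: "0 \<in> V" using diff[of v0 v0] by simp
  have degM: "degree (M v) = m" if "v \<in> V" for v
    unfolding M_def m_def using fin that by (subst degree_prod_sum_eq) auto
  have coeffM: "coeff (M v) m = 1" if "v \<in> V" for v
  proof -
    have "lead_coeff (M v) = 1" unfolding M_def by (subst lead_coeff_prod) simp
    then show ?thesis using degM[OF that] by simp
  qed
  have Mv: "poly (M v) v = c" if "v \<in> V" for v
  proof -
    have "(\<Prod>u\<in>V - {v}. v - u) = (\<Prod>u\<in>V - {0}. u)"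
    proof (rule prod.reindex_bij_witness[where i = "\<lambda>w. v - w" and j = "\<lambda>u. v - u"])
      fix w assume "w \<in> V - {0}"
      then show "v - w \<in> V - {v}" using diff[OF that] by auto
    next
      fix u assume "u \<in> V - {v}"
      then show "v - u \<in> V - {0}" using diff[OF that] by auto
    qed auto
    then show ?thesis unfolding M_def c_def by (simp add: poly_prod)
  qed
  have M0: "poly (M v) u = 0" if "u \<in> V" "u \<noteq> v" for u v
    unfolding M_def using that fin by (auto simp: poly_prod)
  have L: "poly L u = poly (smult c S) u" if "u \<in> V" for u
  proof -
    have "poly L u = (\<Sum>v\<in>V. if v = u then poly S u * c else 0)"
      unfolding L_def poly_sum using Mv M0 that by (intro sum.cong) auto
    then show ?thesis using fin that by simp
  qed
  have "degree L \<le> m" unfolding L_def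
    using degM fin by (intro degree_sum_le) (auto intro: order.trans[OF degree_smult_le])
  then have "L = smult c S"
    using L deg by (intro poly_eqI_degree[of V]) (auto simp: m_def intro: order.strict_trans1[OF degree_smult_le])
  then have "coeff L m = 0" using deg by (simp add: m_def coeff_eq_0)
  moreover have "coeff L m = (\<Sum>v\<in>V. poly S v)"
    unfolding L_def by (simp add: coeff_sum coeffM)
  ultimately show ?thesis by simp
qed

section \<open>Linear maps on finite subspaces as linear polynomials\<close>

definition subspace_over :: "'c::field set \<Rightarrow> 'c set \<Rightarrow> bool" where
  "subspace_over F V \<longleftrightarrow>
     0 \<in> V \<and> (\<forall>u\<in>V. \<forall>v\<in>V. u + v \<in> V) \<and> (\<forall>c\<in>F. \<forall>v\<in>V. c * v \<in> V)"

definition linear_over_on :: "'c::field set \<Rightarrow> 'c set \<Rightarrow> ('c \<Rightarrow> 'c) \<Rightarrow> bool" where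
  "linear_over_on F V f \<longleftrightarrow>
     (\<forall>u\<in>V. \<forall>v\<in>V. f (u + v) = f u + f v) \<and> (\<forall>c\<in>F. \<forall>v\<in>V. f (c * v) = c * f v)"

text \<open>Collects the algebra in characteristic p that the power sums use, free of any metric;
  \<open>C_infinity\<close> is later made an instance.\<close>

locale frobenius_field =
  fixes q :: nat and F :: "'c::alg_closed_field set"
  assumes q_ge_2: "2 \<le> q"
    and frobenius: "\<And>x y :: 'c. (x + y) ^ q = x ^ q + y ^ q"
    and F_eq: "F = Fq q"
    and card_F: "card F = q"
begin

lemma F_iff: "x \<in> F \<longleftrightarrow> x ^ q = x"
  by (simp add: F_eq Fq_def)

lemma finite_F: "finite F"
  using card_F q_ge_2 by (intro card_ge_0_finite) simp

lemma F_0 [simp]: "0 \<in> F" and F_1 [simp]: "1 \<in> F"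
  using q_ge_2 by (auto simp: F_iff)

lemma minus_frobenius: "(- x :: 'c) ^ q = - (x ^ q)"
proof -
  have "x ^ q + (- x) ^ q = 0" using frobenius[of x "- x"] q_ge_2 by (simp add: zero_power)
  then show ?thesis by (metis add.inverse_unique)
qed

lemma F_add: "x \<in> F \<Longrightarrow> y \<in> F \<Longrightarrow> x + y \<in> F"
  and F_mult: "x \<in> F \<Longrightarrow> y \<in> F \<Longrightarrow> x * y \<in> F"
  and F_minus: "x \<in> F \<Longrightarrow> - x \<in> F"
  and F_inverse: "x \<in> F \<Longrightarrow> inverse x \<in> F"
  by (auto simp: F_iff frobenius power_mult_distrib minus_frobenius power_inverse)

lemma F_diff: "x \<in> F \<Longrightarrow> y \<in> F \<Longrightarrow> x - y \<in> F"
  using F_add[of x "- y"] F_minus by simp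

text \<open>The vanishing of power sums, applied to the constant polynomial 1 on F itself, says that
  q times 1 is 0.\<close>

lemma of_nat_q: "of_nat q = (0 :: 'c)"
proof -
  have "(\<Sum>v\<in>F. poly 1 v) = 0"
    using q_ge_2 card_F by (intro sum_poly_additive_subgroup finite_F F_diff) auto
  then show ?thesis using card_F by simp
qed

lemma subspace_diff:
  assumes "subspace_over F V" "u \<in> V" "v \<in> V" shows "u - v \<in> V"
proof -
  have "(- 1) * v \<in> V" using assms F_minus[OF F_1] unfolding subspace_over_def by blast
  then have "u + (- 1) * v \<in> V" using assms unfolding subspace_over_def by blast
  then show ?thesis by simp
qed

text \<open>\<open>E\<close> plays the role of \<open>\<Prod>v\<in>V. X - v\<close>: it is the polynomial needed to extend \<open>R\<close> from
  a subspace to one of the next dimension.\<close>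

lemma linear_interpolation:
  assumes fin: "finite V" and V: "subspace_over F V" and f: "linear_over_on F V f"
  shows "\<exists>E R. degree E = card V \<and> (\<forall>v\<in>V. poly E v = 0) \<and> linear_over_on F UNIV (poly E) \<and>
    degree R * q \<le> card V \<and> (\<forall>v\<in>V. poly R v = f v) \<and> linear_over_on F UNIV (poly R)"
    (is "?P V")
proof -
  \<comment> \<open>In place of an induction on the dimension, a largest subspace W of V admitting
    such polynomials is chosen; if it were proper, adjoining one vector w would give a larger
    one.\<close>
  define Q where "Q = (\<lambda>W. W \<subseteq> V \<and> subspace_over F W \<and> ?P W)"
  have Q0: "Q {0}"
  proof -
    have "f (0 + 0) = f 0 + f 0"
      using V f unfolding subspace_over_def linear_over_on_def by blast
    then have "f 0 = 0" by (simp only: add_0_left add_cancel_right_right)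
    \<comment> \<open>For the zero space, E = X and R = 0 serve: \<open>card {0}\<close> is 1, the
      degree of X.\<close>
    then have "?P {0}"
      by (intro exI[of _ "[:0, 1:]"] exI[of _ 0]) (auto simp: linear_over_on_def)
    then show ?thesis using V unfolding Q_def subspace_over_def by auto
  qed
  have bound: "card W < card V + 1" if "Q W" for W
    using that fin card_mono[of V W] by (auto simp: Q_def)
  obtain W where W: "Q W" and max: "\<And>W'. Q W' \<Longrightarrow> card W' \<le> card W"
    using ex_has_greatest_nat[of Q "{0}" card "card V + 1"] Q0 bound by fastforce
  have "W = V"
  proof (rule ccontr)
    assume "W \<noteq> V"
    then obtain w where w: "w \<in> V" "w \<notin> W" using W Q_def by auto
    obtain E R where E: "degree E = card W" "\<And>v. v \<in> W \<Longrightarrow> poly E v = 0"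
        "linear_over_on F UNIV (poly E)"
      and R: "degree R * q \<le> card W" "\<And>v. v \<in> W \<Longrightarrow> poly R v = f v"
        "linear_over_on F UNIV (poly R)"
      using W unfolding Q_def by auto
    have WV: "W \<subseteq> V" and subW: "subspace_over F W" using W by (auto simp: Q_def)
    then have finW: "finite W" using fin finite_subset by auto
    have "card W > 0" using finW subW by (auto simp: subspace_over_def card_gt_0_iff)
    then have E0: "E \<noteq> 0" using E(1) by auto
    \<comment> \<open>E has degree \<open>card W\<close> and already vanishes on W, so it has no
      further root.\<close>
    have Ew: "poly E w \<noteq> 0"
    proof
      assume "poly E w = 0"
      then have "insert w W \<subseteq> {x. poly E x = 0}" using E by auto
      then have "card (insert w W) \<le> card {x. poly E x = 0}"
        by (intro card_mono poly_roots_finite E0)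
      also have "\<dots> \<le> card W" using card_poly_roots_bound[OF E0] E(1) by simp
      finally show False using finW w by simp
    qed
    define W' where "W' = (\<lambda>(v, c). v + c * w) ` (W \<times> F)"
    \<comment> \<open>On W + Fw the values of E are the multiples c E(w) with c in F, and these are
      roots of Y^q - E(w)^(q-1) Y; substituting E for Y gives \<open>E'\<close>. The constant
      \<open>a\<close> is chosen so that \<open>R'\<close> is correct at w; adding a multiple of E
      leaves the values on W unchanged.\<close>
    define E' where "E' = E ^ q - smult (poly E w ^ (q - 1)) E"
    define a where "a = (f w - poly R w) / poly E w"
    define R' where "R' = R + smult a E"
    have inj: "inj_on (\<lambda>(v, c). v + c * w) (W \<times> F)"
    proof (rule inj_onI, clarsimp)
      fix u c v d assume h: "u \<in> W" "c \<in> F" "v \<in> W" "d \<in> F" "u + c * w = v + d * w"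
      then have eq: "(c - d) * w = v - u" by (simp add: algebra_simps)
      have "c = d"
      proof (rule ccontr)
        assume "c \<noteq> d"
        then have "w = inverse (c - d) * (v - u)"
          using eq by (simp add: field_simps)
        moreover have "inverse (c - d) * (v - u) \<in> W"
          using subW h subspace_diff[OF subW] F_inverse F_diff unfolding subspace_over_def by blast
        ultimately show False using w by simp
      qed
      then show "u = v \<and> c = d" using h by simp
    qed
    have cardW': "card W' = q * card W"
      unfolding W'_def using card_image[OF inj] card_F by (simp add: card_cartesian_product)
    have subW': "subspace_over F W'"
      unfolding subspace_over_def
    proof (intro conjI ballI)
      show "0 \<in> W'" unfolding W'_def using subW
        by (intro image_eqI[of _ _ "(0, 0)"]) (auto simp: subspace_over_def)
    next
      fix x y assume "x \<in> W'" "y \<in> W'"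
      then obtain u c v d where h: "u \<in> W" "c \<in> F" "v \<in> W" "d \<in> F"
        "x = u + c * w" "y = v + d * w" unfolding W'_def by auto
      then show "x + y \<in> W'" unfolding W'_def using subW F_add
        by (intro image_eqI[of _ _ "(u + v, c + d)"]) (auto simp: subspace_over_def algebra_simps)
    next
      fix c x assume "c \<in> F" "x \<in> W'"
      then obtain v d where h: "c \<in> F" "v \<in> W" "d \<in> F" "x = v + d * w"
        unfolding W'_def by auto
      then show "c * x \<in> W'" unfolding W'_def using subW F_mult
        by (intro image_eqI[of _ _ "(c * v, c * d)"]) (auto simp: subspace_over_def algebra_simps)
    qed
    have W'V: "W' \<subseteq> V"
    proof
      fix x assume "x \<in> W'"
      then obtain u c where h: "u \<in> W" "c \<in> F" "x = u + c * w" unfolding W'_def by auto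
      then show "x \<in> V" using V WV w unfolding subspace_over_def by blast
    qed
    have Eadd: "poly E (x + y) = poly E x + poly E y" for x y
      using E(3) by (auto simp: linear_over_on_def)
    have Ec: "c \<in> F \<Longrightarrow> poly E (c * x) = c * poly E x" for c x
      using E(3) by (auto simp: linear_over_on_def)
    have Radd: "poly R (x + y) = poly R x + poly R y" for x y
      using R(3) by (auto simp: linear_over_on_def)
    have Rc: "c \<in> F \<Longrightarrow> poly R (c * x) = c * poly R x" for c x
      using R(3) by (auto simp: linear_over_on_def)
    have degE': "degree E' = card W'"
    proof -
      have "degree (E ^ q) = card W'" using E0 E(1) cardW' by (simp add: degree_power_eq)
      moreover have "degree (smult (poly E w ^ (q - 1)) E) < card W'"
        using degree_smult_le[of "poly E w ^ (q - 1)" E] E(1) cardW' \<open>card W > 0\<close> q_ge_2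
        by (smt (verit) le_trans mult_le_mono1 not_less mult_2 less_add_same_cancel1 leD le_less_trans nle_le)
      ultimately show ?thesis unfolding E'_def
        using degree_add_eq_left[of "- smult (poly E w ^ (q - 1)) E" "E ^ q"] by simp
    qed
    have E'0: "poly E' v = 0" if "v \<in> W'" for v
    proof -
      obtain u c where h: "u \<in> W" "c \<in> F" "v = u + c * w" using \<open>v \<in> W'\<close> unfolding W'_def by auto
      have "poly E v = c * poly E w" using h E(2) by (simp add: Eadd Ec)
      then have "poly E' v = c ^ q * poly E w ^ q - c * (poly E w ^ (q - 1) * poly E w)"
        by (simp add: E'_def power_mult_distrib)
      also have "poly E w ^ (q - 1) * poly E w = poly E w ^ q"
        using q_ge_2 by (intro power_minus_mult) simp
      finally show ?thesis using h F_iff by simp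
    qed
    have linE': "linear_over_on F UNIV (poly E')"
      unfolding linear_over_on_def E'_def
      by (auto simp: Eadd Ec frobenius power_mult_distrib F_iff algebra_simps)
    have linR': "linear_over_on F UNIV (poly R')"
      unfolding linear_over_on_def R'_def by (auto simp: Eadd Ec Radd Rc algebra_simps)
    have R'f: "poly R' v = f v" if "v \<in> W'" for v
    proof -
      obtain u c where h: "u \<in> W" "c \<in> F" "v = u + c * w" using \<open>v \<in> W'\<close> unfolding W'_def by auto
      have "poly R' v = f u + c * (poly R w + a * poly E w)"
        using h E(2) R(2) by (simp add: R'_def Eadd Ec Radd Rc algebra_simps)
      also have "poly R w + a * poly E w = f w" using Ew by (simp add: a_def)
      also have "f u + c * f w = f (u + c * w)"
        using f h V WV w unfolding linear_over_on_def subspace_over_def by (metis subsetD)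
      finally show ?thesis using h by simp
    qed
    \<comment> \<open>The correction term in \<open>R'\<close> has degree at most
      \<open>card W\<close>, which is exactly \<open>card W'\<close> divided by q, so the degree
      bound survives the extension.\<close>
    have "degree R \<le> card W"
      using R(1) q_ge_2 by (metis le_trans mult_le_mono2 mult.right_neutral one_le_numeral)
    then have "degree R' \<le> card W"
      unfolding R'_def using E(1) by (intro degree_add_le order.trans[OF degree_smult_le]) auto
    then have "degree R' * q \<le> card W'" using cardW' by simp
    then have "Q W'" unfolding Q_def using W'V subW' degE' E'0 linE' linR' R'f by blast
    then have "q * card W \<le> card W" using max cardW' by metis
    then show False using q_ge_2 \<open>card W > 0\<close> by simp
  qed
  then show ?thesis using W by (simp add: Q_def)
qed

text \<open>The interpolating R vanishes at 0, so R = X S and f v / v = S(v) away from 0. The sum of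
  S^l over all of V is 0 by degree, and removing the term at v = 0 leaves -(b^l) with b = S(0). That
  one b serves all l up to q is what makes the sums for l and for 1 comparable.\<close>

lemma sum_linear_quotient_power:
  assumes fin: "finite V" and V: "subspace_over F V" and f: "linear_over_on F V f"
  shows "\<exists>b. \<forall>l\<in>{1..q}. (\<Sum>v\<in>V - {0}. (f v / v) ^ l) = - (b ^ l)"
proof -
  obtain R where R: "degree R * q \<le> card V" "\<And>v. v \<in> V \<Longrightarrow> poly R v = f v"
    "linear_over_on F UNIV (poly R)"
    using linear_interpolation[OF assms] by blast
  have "poly R (0 + 0) = poly R 0 + poly R 0" using R(3) unfolding linear_over_on_def by blast
  then have "poly R 0 = 0" by (simp only: add_0_left add_cancel_right_right)
  then obtain S where S: "R = pCons 0 S" by (cases R) auto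
  have quot: "f v / v = poly S v" if "v \<in> V - {0}" for v
    using R(2)[of v] that S by (auto simp: field_simps)
  have "(\<Sum>v\<in>V - {0}. (f v / v) ^ l) = - (poly S 0 ^ l)" if l: "l \<in> {1..q}" for l
  proof (cases "S = 0")
    \<comment> \<open>Treated apart because deg R = deg S + 1 fails here; both sides are 0 as l is
      at least 1.\<close>
    case True
    then show ?thesis using l quot by (simp add: zero_power)
  next
    case False
    have "degree S * l \<le> degree S * q" using l by simp
    moreover have "degree S * q + q \<le> card V" using R(1) S False by (simp add: algebra_simps)
    ultimately have deg: "degree (S ^ l) \<le> card V - q"
      using degree_power_le[of S l] by linarith
    have cV: "q \<le> card V" using \<open>degree S * q + q \<le> card V\<close> by simp
    have "degree (S ^ l) + 1 < card V" using deg cV q_ge_2 by linarith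
    then have "0 = (\<Sum>v\<in>V. poly (S ^ l) v)"
      using sum_poly_additive_subgroup[OF fin subspace_diff[OF V], of "S ^ l"] by simp
    also have "\<dots> = poly S 0 ^ l + (\<Sum>v\<in>V - {0}. (f v / v) ^ l)"
      using fin V quot by (subst sum.remove[of V 0]) (auto simp: subspace_over_def)
    finally show ?thesis by (simp add: add_eq_0_iff)
  qed
  then show ?thesis by blast
qed

section \<open>Twisting by powers of Frobenius\<close>

lemma frobenius_power: "(x + y) ^ q ^ k = x ^ q ^ k + (y :: 'c) ^ q ^ k"
  by (induction k) (simp_all add: frobenius power_mult mult.commute[of q])

lemma frobenius_power_sum: "(\<Sum>i\<in>I. f i :: 'c) ^ q ^ k = (\<Sum>i\<in>I. f i ^ q ^ k)"
  using q_ge_2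
  by (induction I rule: infinite_finite_induct) (simp_all add: frobenius_power zero_power)

lemma F_power: "c \<in> F \<Longrightarrow> c ^ q ^ k = c"
  by (induction k) (simp_all add: F_iff power_mult mult.commute[of q])

lemma minus_frobenius_power: "(- x :: 'c) ^ q ^ k = - (x ^ q ^ k)"
  using F_power[OF F_minus[OF F_1], of k] by (simp add: power_minus[of x])

lemma inj_frobenius_power: "(x :: 'c) ^ q ^ k = y ^ q ^ k \<Longrightarrow> x = y"
  using frobenius_power[of x "- y" k] q_ge_2 by (simp add: minus_frobenius_power)

lemma sum_linear_quotient_twisted:
  assumes fin: "finite V" and V: "subspace_over F V" and f: "linear_over_on F V f"
  shows "\<exists>b. \<forall>l\<in>{1..q}. (\<Sum>v\<in>V - {0}. (f v / v ^ q ^ k) ^ l) = - (b ^ l)"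
proof -
  \<comment> \<open>The roots are chosen pointwise, without regard to linearity. Since
    \<open>q ^ k\<close>-th powers are injective, additive and trivial on F, the linearity of f
    forces that of g.\<close>
  have "\<exists>y. y ^ q ^ k = f v" for v
    using q_ge_2 by (intro nth_root_exists) simp
  then obtain g where g: "\<And>v. g v ^ q ^ k = f v" by metis
  have "linear_over_on F V g"
    unfolding linear_over_on_def
  proof (intro conjI ballI)
    fix u v assume "u \<in> V" "v \<in> V"
    then have "g (u + v) ^ q ^ k = (g u + g v) ^ q ^ k"
      using f by (simp add: g frobenius_power linear_over_on_def)
    then show "g (u + v) = g u + g v" by (rule inj_frobenius_power)
  next
    fix c v assume "c \<in> F" "v \<in> V"
    then have "g (c * v) ^ q ^ k = (c * g v) ^ q ^ k"
      using f by (simp add: g power_mult_distrib F_power linear_over_on_def)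
    then show "g (c * v) = c * g v" by (rule inj_frobenius_power)
  qed
  then obtain b where b: "\<And>l. l \<in> {1..q} \<Longrightarrow> (\<Sum>v\<in>V - {0}. (g v / v) ^ l) = - (b ^ l)"
    using sum_linear_quotient_power[OF fin V] by blast
  have "(\<Sum>v\<in>V - {0}. (f v / v ^ q ^ k) ^ l) = - ((b ^ q ^ k) ^ l)" if "l \<in> {1..q}" for l
  proof -
    have "(\<Sum>v\<in>V - {0}. (f v / v ^ q ^ k) ^ l) = (\<Sum>v\<in>V - {0}. ((g v / v) ^ l) ^ q ^ k)"
      by (intro sum.cong) (simp_all add: power_divide flip: g power_mult, simp add: mult.commute)
    also have "\<dots> = (- (b ^ l)) ^ q ^ k"
      using b[OF that] by (simp flip: frobenius_power_sum)
    finally show ?thesis by (simp add: minus_frobenius_power mult.commute flip: power_mult)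
  qed
  then show ?thesis by blast
qed

text \<open>The form in which the identity is applied: the vectors are parametrised injectively by
  v, and s gives the numerators. Closure is stated through witnesses in I, so it covers both single
  polynomials and pairs of polynomials as indices.\<close>

lemma sum_linear_quotient_indexed:
  assumes fin: "finite I" and inj: "inj_on v I" and ne: "I \<noteq> {}"
    and add: "\<And>i j. i \<in> I \<Longrightarrow> j \<in> I \<Longrightarrow> \<exists>m\<in>I. v m = v i + v j \<and> s m = s i + s j"
    and scale: "\<And>c i. c \<in> F \<Longrightarrow> i \<in> I \<Longrightarrow> \<exists>m\<in>I. v m = c * v i \<and> s m = c * s i"
  shows "\<exists>b. \<forall>l\<in>{1..q}. (\<Sum>i\<in>{i \<in> I. v i \<noteq> 0}. (s i / v i ^ q ^ k) ^ l) = - (b ^ l)"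
proof -
  define f where "f = s \<circ> the_inv_into I v"
  have f: "f (v i) = s i" if "i \<in> I" for i
    using the_inv_into_f_f[OF inj that] by (simp add: f_def)
  obtain i0 where "i0 \<in> I" using ne by auto
  have "subspace_over F (v ` I)"
    unfolding subspace_over_def
  proof (intro conjI ballI)
    obtain m where "m \<in> I" "v m = 0" using scale[OF F_0 \<open>i0 \<in> I\<close>] by auto
    then show "0 \<in> v ` I" by force
  qed (use add scale in \<open>auto; metis image_eqI\<close>)+
  moreover have "linear_over_on F (v ` I) f"
    unfolding linear_over_on_def
  proof (intro conjI ballI; clarify)
    fix i j assume "i \<in> I" "j \<in> I"
    then show "f (v i + v j) = f (v i) + f (v j)" using add f by metis
  next
    fix c i assume "c \<in> F" "i \<in> I"
    then show "f (c * v i) = c * f (v i)" using scale f by metis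
  qed
  ultimately obtain b where b: "\<And>l. l \<in> {1..q} \<Longrightarrow>
      (\<Sum>x\<in>v ` I - {0}. (f x / x ^ q ^ k) ^ l) = - (b ^ l)"
    using sum_linear_quotient_twisted[of "v ` I" f k] fin by blast
  have eq: "(\<Sum>x\<in>v ` I - {0}. (f x / x ^ q ^ k) ^ l) =
      (\<Sum>i\<in>{i \<in> I. v i \<noteq> 0}. (s i / v i ^ q ^ k) ^ l)" for l
  proof -
    have "v ` I - {0} = v ` {i \<in> I. v i \<noteq> 0}" by auto
    moreover have "inj_on v {i \<in> I. v i \<noteq> 0}" using inj by (rule inj_on_subset) auto
    ultimately show ?thesis using f by (simp add: sum.reindex)
  qed
  show ?thesis by (intro exI[of _ b] ballI) (simp only: b flip: eq)
qed

end

text \<open>The polynomial X^q - X splits over the algebraically closed field, and its derivative is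
  -1, so none of its q roots is repeated.\<close>

lemma card_Fq:
  assumes "prime CHAR('c::alg_closed_field)" and "e \<ge> 1" and q: "q = CHAR('c) ^ e"
  shows "card (Fq q :: 'c set) = q"
proof -
  have q2: "2 \<le> q"
    using assms prime_ge_2_nat[of "CHAR('c)"] self_le_power[of "CHAR('c)" e] by linarith
  define f :: "'c poly" where "f = monom 1 q - [:0, 1:]"
  have deg: "degree f = q"
    unfolding f_def diff_conv_add_uminus using q2
    by (subst degree_add_eq_left) (simp_all add: degree_monom_eq)
  then have f0: "f \<noteq> 0" using q2 by auto
  have "of_nat q = (0 :: 'c)" using assms(2) by (simp add: q zero_power)
  then have "pderiv f = - 1"
    by (simp add: f_def pderiv_diff pderiv_monom pderiv_pCons one_pCons)
  have "\<not> [:- a, 1:] ^ 2 dvd f" for a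
  proof
    assume "[:- a, 1:] ^ 2 dvd f"
    then obtain g where "f = [:- a, 1:] ^ 2 * g" by (rule dvdE)
    then have "f = [:- a, 1:] * ([:- a, 1:] * g)" by (simp only: power2_eq_square mult.assoc)
    then have "poly (pderiv f) a = 0"
      by (simp add: pderiv_mult del: mult_pCons_left)
    then show False using \<open>pderiv f = - 1\<close> by simp
  qed
  then have "\<not> 2 \<le> order a f" for a using f0 by (simp add: order_divides)
  then have sq: "rsquarefree f"
    using f0 by (simp add: rsquarefree_def not_le less_2_cases_iff)
  obtain A where A: "size A = degree f" "f = smult (lead_coeff f) (\<Prod>x\<in>#A. [:- x, 1:])"
    using alg_closed_imp_factorization[OF f0] by blast
  have "proots f = proots (\<Prod>x\<in>#A. [:- x, 1:])"
    using A(2) f0 by (metis leading_coeff_0_iff proots_smult)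
  also have "\<dots> = A"
  proof (induction A)
    case (add x A)
    have "proots ([:- x, 1:] * (\<Prod>x\<in>#A. [:- x, 1:])) =
        proots [:- x, 1:] + proots (\<Prod>x\<in>#A. [:- x, 1:])"
      by (intro proots_mult) (auto simp: prod_mset_zero_iff)
    then show ?case using add proots_linear_factor[of x] by simp
  qed simp
  finally have "size (proots f) = q" using A deg by simp
  \<comment> \<open>As every root is simple, the multiset of roots, of size q, is the set of
    roots.\<close>
  moreover have "proots f = mset_set {x. poly f x = 0}"
  proof (rule multiset_eqI)
    fix x
    show "count (proots f) x = count (mset_set {x. poly f x = 0}) x"
      using f0 sq poly_roots_finite[OF f0] rsquarefree_root_order[OF sq]
      by (cases "poly f x = 0") (auto simp: order_root)
  qed
  moreover have "{x. poly f x = 0} = Fq q"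
    by (auto simp: f_def Fq_def poly_monom)
  ultimately show ?thesis by simp
qed

subsection \<open>Ultrametric summation\<close>

context C_infinity
begin

lemma char_ge_2: "2 \<le> p" using prime_p by (rule prime_ge_2_nat)

lemma q_ge_2: "2 \<le> q"
  using char_ge_2 self_le_power[of p e] e_pos q_eq by simp

sublocale frobenius_field q "Fq q :: 'c set"
proof
  show "2 \<le> q" by (rule q_ge_2)
  show "(x + y :: 'c) ^ q = x ^ q + y ^ q" for x y
    using freshmans_dream'[of q e x y] prime_p char_p q_eq by simp
  show "card (Fq q :: 'c set) = q"
    using card_Fq[where 'c = 'c, of e q] prime_p char_p q_eq e_pos by simp
qed simp

section \<open>The absolute value and continuity of the product\<close>

lemma av_nonneg: "0 \<le> av (x :: 'c)" by (simp add: av_def)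

lemma av_eq_0_iff: "av (x :: 'c) = 0 \<longleftrightarrow> x = 0" by (simp add: av_def)

lemma av_zero: "av (0 :: 'c) = 0" by (simp add: av_def)

lemma av_one: "av (1 :: 'c) = 1"
  using av_mult[of 1 1] av_eq_0_iff[of 1] by simp

lemma av_power: "av ((x :: 'c) ^ n) = av x ^ n"
  by (induction n) (simp_all add: av_one av_mult)

lemma av_minus: "av (- x :: 'c) = av x"
  using dist_eq_av[of 0 x] by (simp add: av_def dist_commute)

lemma av_divide: "av (x / y :: 'c) = av x / av y"
proof (cases "y = 0")
  case False
  then have "av (x / y) * av y = av x" by (simp flip: av_mult)
  then show ?thesis using False av_eq_0_iff[of y] by (simp add: field_simps)
qed (simp add: av_zero)

lemma av_add_eq: "av x < av y \<Longrightarrow> av (x + y :: 'c) = av y"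
  using av_ultrametric[of x y] av_ultrametric[of "x + y" "- x"] by (simp add: av_minus)

lemma av_sum_less:
  assumes "0 < \<epsilon>" "\<And>x. x \<in> S \<Longrightarrow> av (f x :: 'c) < \<epsilon>"
  shows "av (sum f S) < \<epsilon>"
  using assms(2)
proof (induction S rule: infinite_finite_induct)
  case (insert x S)
  then show ?case using av_ultrametric[of "f x" "sum f S"] by fastforce
qed (use assms(1) in \<open>simp_all add: av_zero\<close>)

lemma av_Fq: "c \<in> Fq q \<Longrightarrow> c \<noteq> 0 \<Longrightarrow> av (c :: 'c) = 1"
proof -
  assume c: "c \<in> Fq q" "c \<noteq> 0"
  have "av c ^ q = av c" using c by (simp add: Fq_def flip: av_power)
  moreover have "av c ^ q = av c ^ (q - 1) * av c"
    using q_ge_2 by (intro power_minus_mult[symmetric]) simp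
  ultimately have "av c ^ (q - 1) = 1" using c av_eq_0_iff[of c] by simp
  then show ?thesis
    using q_ge_2 av_nonneg[of c] power_eq_imp_eq_base[of "av c" "q - 1" 1] by simp
qed

lemma av_Fq_le: "c \<in> Fq q \<Longrightarrow> av (c :: 'c) \<le> 1"
  using av_Fq[of c] by (cases "c = 0") (auto simp: av_zero)

text \<open>The metric and the field operations are tied together only by the locale assumptions, so
  continuity of the product is derived by expanding f g - a b around (a, b).\<close>

lemma tendsto_mult_av:
  fixes f g :: "'b \<Rightarrow> 'c"
  assumes "(f \<longlongrightarrow> a) G" "(g \<longlongrightarrow> b) G"
  shows "((\<lambda>x. f x * g x) \<longlongrightarrow> a * b) G"
proof -
  have f: "((\<lambda>x. av (f x - a)) \<longlongrightarrow> 0) G" and g: "((\<lambda>x. av (g x - b)) \<longlongrightarrow> 0) G"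
    using assms by (simp_all add: tendsto_dist_iff[of f] tendsto_dist_iff[of g] dist_eq_av)
  have "((\<lambda>x. av (f x - a) * av (g x - b) + (av (f x - a) * av b + av a * av (g x - b)))
      \<longlongrightarrow> 0 * 0 + (0 * av b + av a * 0)) G"
    by (intro tendsto_intros f g)
  then have lim: "((\<lambda>x. av (f x - a) * av (g x - b) + (av (f x - a) * av b + av a * av (g x - b)))
      \<longlongrightarrow> 0) G" by simp
  have bound: "av (f x * g x - a * b) \<le>
      av (f x - a) * av (g x - b) + (av (f x - a) * av b + av a * av (g x - b))" for x
  proof -
    have tri: "av (u + v :: 'c) \<le> av u + av v" for u v
      using av_ultrametric[of u v] av_nonneg[of u] av_nonneg[of v] by linarith
    have "f x * g x - a * b = (f x - a) * (g x - b) + ((f x - a) * b + a * (g x - b))"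
      by (simp add: algebra_simps)
    then show ?thesis
      using tri[of "(f x - a) * (g x - b)" "(f x - a) * b + a * (g x - b)"]
        tri[of "(f x - a) * b" "a * (g x - b)"] by (simp add: av_mult)
  qed
  have "((\<lambda>x. av (f x * g x - a * b)) \<longlongrightarrow> 0) G"
    by (rule tendsto_sandwich[OF _ _ tendsto_const lim])
      (use bound in \<open>simp_all add: av_nonneg del: minus_mult_right\<close>)
  then show ?thesis by (simp add: tendsto_dist_iff[of "\<lambda>x. f x * g x"] dist_eq_av)
qed

lemma tendsto_power_av: "((f :: 'b \<Rightarrow> 'c) \<longlongrightarrow> a) G \<Longrightarrow> ((\<lambda>x. f x ^ n) \<longlongrightarrow> a ^ n) G"
  by (induction n) (simp_all add: tendsto_mult_av)

text \<open>In an ultrametric field a finite sum of small terms is small. So if the terms outside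
  \<open>B n\<close> become uniformly small, every finite set containing \<open>B n\<close> has
  nearly the same sum, which gives unconditional summability and identifies the sum with the limit
  along B.\<close>

lemma has_sum_exhaustion:
  fixes f :: "'b \<Rightarrow> 'c" and B :: "nat \<Rightarrow> 'b set"
  assumes fin: "\<And>n. finite (B n)" and mono: "mono B"
    and small: "\<And>\<epsilon>. 0 < \<epsilon> \<Longrightarrow> \<exists>n. \<forall>x\<in>(\<Union>m. B m) - B n. av (f x) < \<epsilon>"
  shows "\<exists>S. (f has_sum S) (\<Union>m. B m) \<and> (\<lambda>n. sum f (B n)) \<longlonglongrightarrow> S"
proof -
  let ?X = "\<Union>m. B m"
  have close: "\<exists>n. \<forall>T. finite T \<longrightarrow> B n \<subseteq> T \<longrightarrow> T \<subseteq> ?X \<longrightarrow> dist (sum f T) (sum f (B n)) < \<epsilon>"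
    if "0 < \<epsilon>" for \<epsilon>
  proof -
    obtain n where n: "\<forall>x\<in>?X - B n. av (f x) < \<epsilon>" using small \<open>0 < \<epsilon>\<close> by blast
    have "dist (sum f T) (sum f (B n)) < \<epsilon>" if "finite T" "B n \<subseteq> T" "T \<subseteq> ?X" for T
    proof -
      have "sum f T - sum f (B n) = sum f (T - B n)"
        using that by (simp add: sum_diff)
      moreover have "av (sum f (T - B n)) < \<epsilon>"
        using n that by (intro av_sum_less \<open>0 < \<epsilon>\<close>) blast
      ultimately show ?thesis by (simp add: dist_eq_av)
    qed
    then show ?thesis by blast
  qed
  have "Cauchy (\<lambda>n. sum f (B n))"
  proof (rule metric_CauchyI)
    fix \<epsilon> :: real assume "0 < \<epsilon>"
    then obtain n where n: "\<And>T. finite T \<Longrightarrow> B n \<subseteq> T \<Longrightarrow> T \<subseteq> ?X \<Longrightarrow>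
        dist (sum f T) (sum f (B n)) < \<epsilon> / 2" using close[of "\<epsilon> / 2"] by auto
    have "dist (sum f (B i)) (sum f (B n)) < \<epsilon> / 2" if "n \<le> i" for i
      using n[OF fin, of i] monoD[OF mono that] by blast
    then show "\<exists>M. \<forall>m\<ge>M. \<forall>n\<ge>M. dist (sum f (B m)) (sum f (B n)) < \<epsilon>"
      by (intro exI[of _ n] allI impI) (rule dist_triangle_half_l)
  qed
  then obtain S where S: "(\<lambda>n. sum f (B n)) \<longlonglongrightarrow> S"
    using Cauchy_convergent convergentD by blast
  have "(f has_sum S) ?X"
    unfolding has_sum_def
  proof (rule tendstoI)
    fix \<epsilon> :: real assume "0 < \<epsilon>"
    then obtain n where n: "\<And>T. finite T \<Longrightarrow> B n \<subseteq> T \<Longrightarrow> T \<subseteq> ?X \<Longrightarrow>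
        dist (sum f T) (sum f (B n)) < \<epsilon> / 2 / 2" using close[of "\<epsilon> / 2 / 2"] by auto
    have "\<forall>\<^sub>F m in sequentially. dist (sum f (B m)) S < \<epsilon> / 2 / 2 \<and> n \<le> m"
      using S \<open>0 < \<epsilon>\<close> by (intro eventually_conj tendstoD eventually_ge_at_top) auto
    then obtain m where "dist (sum f (B m)) S < \<epsilon> / 2 / 2" "n \<le> m"
      using eventually_happens'[OF sequentially_bot] by blast
    moreover from this have "dist (sum f (B m)) (sum f (B n)) < \<epsilon> / 2 / 2"
      using n[OF fin, of m] monoD[OF mono] by blast
    ultimately have nS: "dist (sum f (B n)) S < \<epsilon> / 2"
      by (metis dist_commute dist_triangle_half_l)
    have "dist (sum f T) S < \<epsilon>" if "finite T" "B n \<subseteq> T" "T \<subseteq> ?X" for T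
      using n[OF that] nS dist_triangle[of "sum f T" S "sum f (B n)"] zero_le_dist[of "sum f T" "sum f (B n)"]
      by linarith
    then show "\<forall>\<^sub>F T in finite_subsets_at_top ?X. dist (sum f T) S < \<epsilon>"
      unfolding eventually_finite_subsets_at_top using fin by (intro exI[of _ "B n"]) auto
  qed
  then show ?thesis using S by blast
qed

text \<open>Carries an identity between finite power sums to the limit. Requiring
  \<open>av (g x)\<close> to be below 1 as well as \<epsilon> makes the l-th powers no larger than
  the terms, so they are summable too.\<close>

lemma infsum_power:
  fixes g :: "'b \<Rightarrow> 'c" and B :: "nat \<Rightarrow> 'b set"
  assumes fin: "\<And>n. finite (B n)" and mono: "mono B"
    and small: "\<And>\<epsilon>. 0 < \<epsilon> \<Longrightarrow> \<exists>n. \<forall>x\<in>(\<Union>m. B m) - B n. av (g x) < \<epsilon>"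
    and l: "1 \<le> l" and eq: "\<And>n. (\<Sum>x\<in>B n. g x ^ l) = \<kappa> * (\<Sum>x\<in>B n. g x) ^ l"
  shows "(\<Sum>\<^sub>\<infinity>x\<in>(\<Union>m. B m). g x ^ l) = \<kappa> * (\<Sum>\<^sub>\<infinity>x\<in>(\<Union>m. B m). g x) ^ l"
proof -
  have "\<exists>n. \<forall>x\<in>(\<Union>m. B m) - B n. av (g x ^ l) < \<epsilon>" if "0 < \<epsilon>" for \<epsilon>
  proof -
    obtain n where n: "\<forall>x\<in>(\<Union>m. B m) - B n. av (g x) < min 1 \<epsilon>"
      using small[of "min 1 \<epsilon>"] \<open>0 < \<epsilon>\<close> by auto
    have "av (g x ^ l) < \<epsilon>" if "x \<in> (\<Union>m. B m) - B n" for x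
    proof -
      have lt: "av (g x) < 1" "av (g x) < \<epsilon>" using n that by auto
      then have "av (g x) ^ l \<le> av (g x)"
        using l power_decreasing[of 1 l "av (g x)"] av_nonneg[of "g x"] by simp
      then show ?thesis using lt by (simp add: av_power)
    qed
    then show ?thesis by blast
  qed
  then obtain S where S: "((\<lambda>x. g x ^ l) has_sum S) (\<Union>m. B m)"
      "(\<lambda>n. \<Sum>x\<in>B n. g x ^ l) \<longlonglongrightarrow> S"
    using has_sum_exhaustion[OF fin mono, of "\<lambda>x. g x ^ l"] by blast
  obtain T where T: "(g has_sum T) (\<Union>m. B m)" "(\<lambda>n. \<Sum>x\<in>B n. g x) \<longlonglongrightarrow> T"
    using has_sum_exhaustion[OF fin mono small] by blast
  have "(\<lambda>n. \<kappa> * (\<Sum>x\<in>B n. g x) ^ l) \<longlonglongrightarrow> \<kappa> * T ^ l"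
    by (intro tendsto_mult_av tendsto_const tendsto_power_av T)
  then have "S = \<kappa> * T ^ l" using S(2) LIMSEQ_unique by (simp add: eq)
  then show ?thesis using infsumI[OF S(1)] infsumI[OF T(1)] by simp
qed

subsection \<open>Lattice sums\<close>

lemma A_ring_iff: "a \<in> A_ring q \<longleftrightarrow> (\<forall>i. coeff a i \<in> (Fq q :: 'c set))"
  by (simp add: A_ring_def)

lemma A_ring_pCons_iff: "pCons c a \<in> A_ring q \<longleftrightarrow> (c :: 'c) \<in> Fq q \<and> a \<in> A_ring q"
proof -
  have "pCons c a \<in> A_ring q \<longleftrightarrow> (\<forall>i. case_nat c (coeff a) i \<in> Fq q)"
    by (simp add: A_ring_iff coeff_pCons)
  then show ?thesis by (auto simp: A_ring_iff split: nat.split)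
qed

lemma A_ring_0: "(0 :: 'c poly) \<in> A_ring q"
  by (simp add: A_ring_iff)

lemma A_ring_add: "a \<in> A_ring q \<Longrightarrow> b \<in> A_ring q \<Longrightarrow> (a + b :: 'c poly) \<in> A_ring q"
  by (simp add: A_ring_iff F_add)

lemma A_ring_smult: "c \<in> Fq q \<Longrightarrow> a \<in> A_ring q \<Longrightarrow> smult (c :: 'c) a \<in> A_ring q"
  by (simp add: A_ring_iff F_mult)

lemma A_ring_minus: "a \<in> A_ring q \<Longrightarrow> (- a :: 'c poly) \<in> A_ring q"
  by (simp add: A_ring_iff F_minus)

text \<open>By Horner's rule: coefficients have absolute value at most 1, so each degree costs at
  most one factor |t|, or 1 when |t| < 1.\<close>

lemma av_poly_le:
  fixes t :: 'c
  shows "a \<in> A_ring q \<Longrightarrow> av (poly a t) \<le> max 1 (av t) ^ degree a"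
proof (induction a)
  case (pCons c a)
  then have c: "av c \<le> 1" and a: "a \<in> A_ring q" by (auto simp: A_ring_pCons_iff av_Fq_le)
  show ?case
  proof (cases "a = 0")
    case False
    have "1 \<le> max 1 (av t) * max 1 (av t) ^ degree a"
      by (simp flip: power_Suc add: one_le_power)
    moreover have "av (t * poly a t) \<le> max 1 (av t) * max 1 (av t) ^ degree a"
      unfolding av_mult using pCons.IH[OF a] by (intro mult_mono) (auto simp: av_nonneg)
    ultimately show ?thesis using c av_ultrametric[of c "t * poly a t"] False by simp
  qed (use c in simp)
qed (simp add: av_zero)

lemma av_poly_theta:
  "a \<in> A_ring q \<Longrightarrow> a \<noteq> 0 \<Longrightarrow> av (poly a \<theta>) = real q ^ degree a"
proof (induction a)
  case (pCons c a)
  then have c: "c \<in> Fq q" and a: "a \<in> A_ring q" by (auto simp: A_ring_pCons_iff)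
  show ?case
  proof (cases "a = 0")
    case True
    then show ?thesis using pCons.prems c by (simp add: av_Fq)
  next
    case False
    have "av (\<theta> * poly a \<theta>) = real q ^ Suc (degree a)"
      using pCons.IH[OF a False] by (simp add: av_mult av_theta)
    moreover have "1 < real q ^ Suc (degree a)" using q_ge_2 by (intro one_less_power) simp_all
    ultimately show ?thesis using av_Fq_le[OF c] av_add_eq[of c "\<theta> * poly a \<theta>"] False by simp
  qed
qed simp

lemma poly_theta_eq_0_iff: "a \<in> A_ring q \<Longrightarrow> poly a \<theta> = 0 \<longleftrightarrow> a = 0"
  using av_poly_theta[of a] q_ge_2 av_zero by force

text \<open>As \<open>K_inf\<close> is closed, z keeps a distance \<epsilon> from it, so |cz + d| =
  |c| |z + d/c| is at least \<epsilon> |c|. If d has the larger degree, then either d dominates and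
  |cz + d| = |d|, or |d| is at most |c| |z| and the same bound suffices. This yields both the
  injectivity of (c, d) to cz + d and the decay of the lattice terms.\<close>

lemma lattice_lower_bound:
  assumes z: "z \<in> Omega q \<theta>"
  shows "\<exists>\<delta>>0. \<forall>c\<in>A_ring q. \<forall>d\<in>A_ring q. (c, d) \<noteq> (0, 0) \<longrightarrow>
    \<delta> * real q ^ max (degree c) (degree d) \<le> av (poly c \<theta> * z + poly d \<theta>)"
proof -
  have "open (- K_inf q \<theta>)" and "z \<in> - K_inf q \<theta>"
    using z by (auto simp: K_inf_def Omega_def)
  then obtain \<epsilon> where \<epsilon>: "0 < \<epsilon>" "ball z \<epsilon> \<subseteq> - K_inf q \<theta>"
    by (meson open_contains_ball)
  \<comment> \<open>The bound 1 handles the cases where d dominates; the other one handles |d| at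
    most |c| |z|. Using 1 + |z| in place of |z| also ensures that \<delta> is at most
    \<epsilon>.\<close>
  define \<delta> where "\<delta> = min 1 (\<epsilon> / (1 + av z))"
  have pos: "0 < 1 + av z" using av_nonneg[of z] by simp
  have \<delta>: "0 < \<delta>" "\<delta> \<le> 1" "\<delta> \<le> \<epsilon> / (1 + av z)"
    using \<epsilon>(1) pos by (auto simp: \<delta>_def)
  have "\<epsilon> / (1 + av z) \<le> \<epsilon>" using \<epsilon>(1) pos av_nonneg[of z] by (simp add: field_simps)
  then have \<delta>': "\<delta> \<le> \<epsilon>" using \<delta> by simp
  have le: "\<delta> * real q ^ n \<le> real q ^ n" for n
    using \<delta> by (intro mult_left_le_one_le) auto
  have "\<delta> * real q ^ max (degree c) (degree d) \<le> av (poly c \<theta> * z + poly d \<theta>)"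
    if c: "c \<in> A_ring q" and d: "d \<in> A_ring q" and ne: "(c, d) \<noteq> (0, 0)" for c d
  proof (cases "c = 0")
    case True
    then have "av (poly c \<theta> * z + poly d \<theta>) = real q ^ max (degree c) (degree d)"
      using ne d by (simp add: av_poly_theta)
    then show ?thesis by (simp only: le)
  next
    case False
    have c0: "poly c \<theta> \<noteq> 0" using False c by (simp add: poly_theta_eq_0_iff)
    have avc: "av (poly c \<theta>) = real q ^ degree c" using False c by (simp add: av_poly_theta)
    have "poly (- d) \<theta> / poly c \<theta> \<in> K_inf q \<theta>"
      using A_ring_minus[OF d] c False closure_subset[of "K_frac q \<theta>"]
      unfolding K_inf_def K_frac_def by blast
    then have "\<epsilon> \<le> dist z (poly (- d) \<theta> / poly c \<theta>)" using \<epsilon>(2) by force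
    also have "\<dots> = av ((poly c \<theta> * z + poly d \<theta>) / poly c \<theta>)"
      using c0 by (simp add: dist_eq_av field_simps)
    finally have lower: "\<epsilon> * real q ^ degree c \<le> av (poly c \<theta> * z + poly d \<theta>)"
      using q_ge_2 by (simp add: av_divide avc pos_le_divide_eq)
    show ?thesis
    proof (cases "degree d \<le> degree c")
      case True
      then show ?thesis
        using lower mult_right_mono[OF \<delta>', of "real q ^ degree c"] by (simp add: max_def)
    next
      case False
      then have "d \<noteq> 0" by auto
      then have avd: "av (poly d \<theta>) = real q ^ degree d" using d by (simp add: av_poly_theta)
      show ?thesis
      proof (cases "av (poly c \<theta> * z) < av (poly d \<theta>)")
        case True
        then have "av (poly c \<theta> * z + poly d \<theta>) = real q ^ degree d"
          using av_add_eq avd by simp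
        then show ?thesis using False le by (simp add: max_def)
      next
        case not_less: False
        then have "real q ^ degree d \<le> real q ^ degree c * av z"
          by (simp add: avd av_mult avc)
        also have "\<dots> \<le> real q ^ degree c * (1 + av z)" by (intro mult_left_mono) auto
        finally have "\<delta> * real q ^ degree d \<le> \<epsilon> / (1 + av z) * (real q ^ degree c * (1 + av z))"
          using \<delta> \<epsilon>(1) pos by (intro mult_mono) auto
        also have "\<dots> = \<epsilon> * real q ^ degree c" using pos by simp
        finally show ?thesis using lower False by (simp add: max_def)
      qed
    qed
  qed
  then show ?thesis using \<delta>(1) by blast
qed

section \<open>Exhaustion of A by finite subspaces and decay of the terms\<close>

definition A_le :: "nat \<Rightarrow> 'c poly set" where
  "A_le n = {a \<in> A_ring q. degree a \<le> n}"

lemma finite_A_le: "finite (A_le n)"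
proof -
  have "a \<in> Poly ` {xs. set xs \<subseteq> Fq q \<and> length xs \<le> Suc n}" if "a \<in> A_le n" for a
  proof (rule image_eqI)
    show "a = Poly (coeffs a)" by simp
    show "coeffs a \<in> {xs. set xs \<subseteq> Fq q \<and> length xs \<le> Suc n}"
      using that by (auto simp: A_le_def A_ring_iff coeffs_def length_coeffs)
  qed
  then have "A_le n \<subseteq> Poly ` {xs. set xs \<subseteq> Fq q \<and> length xs \<le> Suc n}" by blast
  then show ?thesis using finite_lists_length_le[OF finite_F] finite_subset by blast
qed

lemma A_le_add: "a \<in> A_le n \<Longrightarrow> b \<in> A_le n \<Longrightarrow> a + b \<in> A_le n"
  by (simp add: A_le_def A_ring_add degree_add_le)

lemma A_le_smult: "c \<in> Fq q \<Longrightarrow> a \<in> A_le n \<Longrightarrow> smult c a \<in> A_le n"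
  by (simp add: A_le_def A_ring_smult)

lemma A_le_0: "0 \<in> A_le n"
  by (simp add: A_le_def A_ring_0)

lemma small_terms:
  fixes g :: "'b \<Rightarrow> 'c" and B :: "nat \<Rightarrow> 'b set" and m :: "'b \<Rightarrow> nat"
  assumes bound: "\<And>x. x \<in> X \<Longrightarrow> av (g x) \<le> M * \<rho> ^ m x"
    and \<rho>: "0 \<le> \<rho>" "\<rho> < 1" and outside: "\<And>n x. x \<in> X - B n \<Longrightarrow> n \<le> m x"
    and "0 < \<epsilon>"
  shows "\<exists>n. \<forall>x\<in>X - B n. av (g x) < \<epsilon>"
proof -
  have "(\<lambda>n. \<bar>M\<bar> * \<rho> ^ n) \<longlonglongrightarrow> \<bar>M\<bar> * 0"
    using \<rho> by (intro tendsto_mult_left LIMSEQ_power_zero) simp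
  then have "\<forall>\<^sub>F n in sequentially. \<bar>M\<bar> * \<rho> ^ n < \<epsilon>"
    using \<open>0 < \<epsilon>\<close> by (intro order_tendstoD) auto
  then obtain n where n: "\<bar>M\<bar> * \<rho> ^ n < \<epsilon>"
    by (auto simp: eventually_sequentially)
  have "av (g x) < \<epsilon>" if "x \<in> X - B n" for x
  proof -
    have "av (g x) \<le> M * \<rho> ^ m x" using bound that by simp
    also have "\<dots> \<le> \<bar>M\<bar> * \<rho> ^ m x" using \<rho> by (intro mult_right_mono) auto
    also have "\<dots> \<le> \<bar>M\<bar> * \<rho> ^ n"
      using outside[OF that] \<rho> by (intro mult_left_mono power_decreasing) auto
    finally show ?thesis using n by simp
  qed
  then show ?thesis by blast
qed

text \<open>Here the radius of the disc enters: raising the degree by one multiplies the bound for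
  the numerator by max 1 |t| and that for the denominator by \<open>real q ^ q ^ k\<close>.\<close>

lemma ratio_bound:
  assumes "t \<in> B_disc (real q ^ q ^ k)"
  shows "0 \<le> max 1 (av (t :: 'c)) / real q ^ q ^ k" "max 1 (av t) / real q ^ q ^ k < 1"
proof -
  have "1 < real q ^ q ^ k" using q_ge_2 by (intro one_less_power) auto
  then show "0 \<le> max 1 (av t) / real q ^ q ^ k" "max 1 (av t) / real q ^ q ^ k < 1"
    using assms by (auto simp: B_disc_def divide_less_eq)
qed

text \<open>The finite identity holds on each space of pairs of bounded degree, and
  \<open>lattice_lower_bound\<close> gives the geometric decay needed to pass to the limit.
  Arbitrary x and y stand for the values of \<open>d1\<close> and \<open>d2\<close>.\<close>

lemma lattice_sum_power:
  fixes x y z t :: 'c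
  assumes z: "z \<in> Omega q \<theta>" and t: "t \<in> B_disc (real q ^ q ^ k)" and l: "1 \<le> l" "l \<le> q"
  defines "g \<equiv> \<lambda>(c, d). (poly c t * x + poly d t * y) / (poly c \<theta> * z + poly d \<theta>) ^ q ^ k"
  shows "(\<Sum>\<^sub>\<infinity>i\<in>A_ring q \<times> A_ring q - {(0, 0)}. g i ^ l) =
    (- 1) ^ (l + 1) * (\<Sum>\<^sub>\<infinity>i\<in>A_ring q \<times> A_ring q - {(0, 0)}. g i) ^ l"
proof -
  define B where "B = (\<lambda>n. A_le n \<times> A_le n - {(0, 0)})"
  define v where "v = (\<lambda>(c, d). poly c \<theta> * z + poly d \<theta>)"
  define s where "s = (\<lambda>(c, d). poly c t * x + poly d t * y)"
  define m where "m = (\<lambda>(c :: 'c poly, d :: 'c poly). max (degree c) (degree d))"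
  have g: "g i = s i / v i ^ q ^ k" for i
    by (cases i) (simp add: g_def s_def v_def)
  obtain \<delta> where \<delta>: "0 < \<delta>" and lower: "\<forall>c\<in>A_ring q. \<forall>d\<in>A_ring q. (c, d) \<noteq> (0, 0) \<longrightarrow>
      \<delta> * real q ^ max (degree c) (degree d) \<le> av (poly c \<theta> * z + poly d \<theta>)"
    using lattice_lower_bound[OF z] by (elim exE conjE)
  have low: "\<delta> * real q ^ m i \<le> av (v i)" if "i \<in> A_ring q \<times> A_ring q - {(0, 0)}" for i
    using lower that by (cases i) (simp add: m_def v_def)
  have v0: "v i \<noteq> 0" if "i \<in> A_ring q \<times> A_ring q - {(0, 0)}" for i
  proof -
    have "0 < \<delta> * real q ^ m i" using \<delta> q_ge_2 by simp
    then show ?thesis using low[OF that] av_zero by auto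
  qed
  have UB: "(\<Union>n. B n) = A_ring q \<times> A_ring q - {(0, 0)}"
  proof
    show "A_ring q \<times> A_ring q - {(0, 0)} \<subseteq> (\<Union>n. B n)"
    proof
      fix i :: "'c poly \<times> 'c poly" assume "i \<in> A_ring q \<times> A_ring q - {(0, 0)}"
      then have "i \<in> B (m i)" by (auto simp: B_def A_le_def m_def)
      then show "i \<in> (\<Union>n. B n)" by blast
    qed
  qed (auto simp: B_def A_le_def)
  have finB: "finite (B n)" for n by (simp add: B_def finite_A_le)
  have monoB: "mono B" by (rule monoI) (auto simp: B_def A_le_def)
  have eq: "(\<Sum>i\<in>B n. g i ^ l) = (- 1) ^ (l + 1) * (\<Sum>i\<in>B n. g i) ^ l" for n
  proof -
    let ?I = "A_le n \<times> A_le n"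
    have vdiff: "v (c, d) - v (c', d') = v (c - c', d - d')" for c d c' d'
      by (simp add: v_def algebra_simps)
    have "inj_on v ?I"
    proof (rule inj_onI, clarify)
      fix c d c' d' assume h: "c \<in> A_le n" "d \<in> A_le n" "c' \<in> A_le n" "d' \<in> A_le n"
        "v (c, d) = v (c', d')"
      then have "(c - c', d - d') \<in> A_ring q \<times> A_ring q"
        using A_ring_add[of _ "- c'"] A_ring_add[of _ "- d'"] by (auto simp: A_le_def A_ring_minus)
      moreover have "v (c - c', d - d') = 0" using h(5) by (simp flip: vdiff)
      ultimately have "(c - c', d - d') = (0, 0)" using v0 by blast
      then show "c = c' \<and> d = d'" by simp
    qed
    moreover have "\<exists>m\<in>?I. v m = v i + v j \<and> s m = s i + s j" if "i \<in> ?I" "j \<in> ?I" for i j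
      using that A_le_add
      by (intro bexI[of _ "(fst i + fst j, snd i + snd j)"]) (auto simp: v_def s_def algebra_simps)
    moreover have "\<exists>m\<in>?I. v m = a * v i \<and> s m = a * s i" if "a \<in> Fq q" "i \<in> ?I" for a i
      using that A_le_smult
      by (intro bexI[of _ "(smult a (fst i), smult a (snd i))"]) (auto simp: v_def s_def algebra_simps)
    moreover have "?I \<noteq> {}" using A_le_0 by auto
    moreover have "finite ?I" by (simp add: finite_A_le)
    ultimately obtain b where b: "\<And>l. l \<in> {1..q} \<Longrightarrow>
        (\<Sum>i\<in>{i \<in> ?I. v i \<noteq> 0}. (s i / v i ^ q ^ k) ^ l) = - (b ^ l)"
      using sum_linear_quotient_indexed[of ?I v s k] by blast
    \<comment> \<open>Only the pair (0, 0) is sent to 0, so omitting zero vectors and omitting the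
      origin are the same.\<close>
    have "{i \<in> ?I. v i \<noteq> 0} = B n"
    proof
      show "B n \<subseteq> {i \<in> ?I. v i \<noteq> 0}" using v0 by (auto simp: B_def A_le_def)
      have "v (0, 0) = 0" by (simp add: v_def)
      then show "{i \<in> ?I. v i \<noteq> 0} \<subseteq> B n" by (auto simp: B_def)
    qed
    then have b: "(\<Sum>i\<in>B n. g i ^ l) = - (b ^ l)" if "l \<in> {1..q}" for l
      using b[OF that] by (simp add: g)
    \<comment> \<open>The sum for exponent 1 is -b, and -(b^l) = (-1)^(l+1) (-b)^l.\<close>
    show ?thesis using b[of 1] b[of l] l q_ge_2 by (simp add: power_minus[of b])
  qed
  have bound: "av (g i) \<le> max (av x) (av y) / \<delta> ^ q ^ k * (max 1 (av t) / real q ^ q ^ k) ^ m i"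
    if i: "i \<in> A_ring q \<times> A_ring q - {(0, 0)}" for i
  proof -
    obtain c d where cd: "i = (c, d)" by (cases i)
    have deg: "av (poly a t) \<le> max 1 (av t) ^ m i" if "a \<in> {c, d}" for a
    proof -
      have "av (poly a t) \<le> max 1 (av t) ^ degree a" using that i cd by (intro av_poly_le) auto
      also have "\<dots> \<le> max 1 (av t) ^ m i"
        using that cd by (intro power_increasing) (auto simp: m_def)
      finally show ?thesis .
    qed
    have "av (poly c t * x) \<le> max 1 (av t) ^ m i * max (av x) (av y)"
      "av (poly d t * y) \<le> max 1 (av t) ^ m i * max (av x) (av y)"
      unfolding av_mult using deg by (auto intro!: mult_mono simp: av_nonneg)
    then have num: "av (s i) \<le> max 1 (av t) ^ m i * max (av x) (av y)"
      using av_ultrametric[of "poly c t * x" "poly d t * y"] by (simp add: s_def cd)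
    have den: "(\<delta> * real q ^ m i) ^ q ^ k \<le> av (v i ^ q ^ k)"
      unfolding av_power using low[OF i] \<delta> by (intro power_mono) auto
    have "av (g i) \<le> (max 1 (av t) ^ m i * max (av x) (av y)) / (\<delta> * real q ^ m i) ^ q ^ k"
      unfolding g av_divide using num den \<delta> q_ge_2
      by (intro frac_le) (auto simp: av_nonneg le_max_iff_disj)
    also have "\<dots> = max (av x) (av y) / \<delta> ^ q ^ k * (max 1 (av t) / real q ^ q ^ k) ^ m i"
      by (simp add: power_mult_distrib power_divide mult.commute flip: power_mult)
    finally show ?thesis .
  qed
  have "\<exists>n. \<forall>i\<in>(\<Union>m. B m) - B n. av (g i) < \<epsilon>" if "0 < \<epsilon>" for \<epsilon>
    unfolding UB
  proof (rule small_terms[OF bound ratio_bound[OF t] _ that])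
    fix n i assume "i \<in> A_ring q \<times> A_ring q - {(0, 0)} - B n"
    then show "n \<le> m i" by (cases i) (auto simp: B_def A_le_def m_def)
  qed
  from infsum_power[OF finB monoB this l(1) eq] show ?thesis unfolding UB .
qed

text \<open>Monic polynomials do not form a subspace, so the identity is taken on
  \<open>A_le n\<close> and then divided among the scalar multiples of the monic ones. The resulting
  factor q - 1 = -1 cancels the sign of -(b^l).\<close>

lemma L_chi_power:
  assumes t: "t \<in> B_disc (real q ^ q ^ k)" and l: "1 \<le> l" "l \<le> q"
  shows "L_chi q \<theta> l (l * q ^ k) t = L_chi q \<theta> 1 (q ^ k) t ^ l"
proof -
  define g where "g = (\<lambda>a. poly a t / poly a \<theta> ^ q ^ k)"
  define B where "B = (\<lambda>n. A_plus q \<inter> A_le n)"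
  have UB: "(\<Union>n. B n) = A_plus q" by (auto simp: B_def A_le_def A_plus_def)
  have finB: "finite (B n)" for n by (simp add: B_def finite_A_le)
  have monoB: "mono B" by (rule monoI) (auto simp: B_def A_le_def)
  have eq: "(\<Sum>a\<in>B n. g a ^ l) = 1 * (\<Sum>a\<in>B n. g a) ^ l" for n
  proof -
    let ?v = "\<lambda>a. poly a \<theta>"
    have "inj_on ?v (A_le n)"
    proof (rule inj_onI)
      fix a b assume h: "a \<in> A_le n" "b \<in> A_le n" "poly a \<theta> = poly b \<theta>"
      then have "a - b \<in> A_ring q"
        using A_ring_add[of a "- b"] by (auto simp: A_le_def A_ring_minus)
      then show "a = b" using h(3) poly_theta_eq_0_iff[of "a - b"] by simp
    qed
    moreover have "\<exists>m\<in>A_le n. ?v m = ?v i + ?v j \<and> poly m t = poly i t + poly j t"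
      if "i \<in> A_le n" "j \<in> A_le n" for i j
      using that by (intro bexI[of _ "i + j"]) (auto simp: A_le_add)
    moreover have "\<exists>m\<in>A_le n. ?v m = c * ?v i \<and> poly m t = c * poly i t"
      if "c \<in> Fq q" "i \<in> A_le n" for c i
      using that by (intro bexI[of _ "smult c i"]) (auto simp: A_le_smult)
    moreover have "A_le n \<noteq> {}" using A_le_0 by auto
    ultimately obtain b where b: "\<And>l. l \<in> {1..q} \<Longrightarrow>
        (\<Sum>a\<in>{a \<in> A_le n. ?v a \<noteq> 0}. (poly a t / ?v a ^ q ^ k) ^ l) = - (b ^ l)"
      using sum_linear_quotient_indexed[of "A_le n" ?v "\<lambda>a. poly a t" k] finite_A_le by blast
    have "(\<Sum>a\<in>B n. g a ^ l) = b ^ l" if "l \<in> {1..q}" for l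
    proof -
      \<comment> \<open>Each nonzero polynomial is uniquely its leading coefficient times a monic
        one, and g does not change under scaling by c because c^(q^k) = c.\<close>
      have "(\<Sum>(c, a)\<in>(Fq q - {0 :: 'c}) \<times> B n. g a ^ l) = (\<Sum>a\<in>{a \<in> A_le n. ?v a \<noteq> 0}. g a ^ l)"
      proof (rule sum.reindex_bij_witness[where j = "\<lambda>(c :: 'c, a). smult c a"
            and i = "\<lambda>a :: 'c poly. (lead_coeff a, smult (inverse (lead_coeff a)) a)"])
        fix a assume "a \<in> {a \<in> A_le n. ?v a \<noteq> 0}"
        then have a: "a \<in> A_le n" "a \<noteq> 0" "lead_coeff a \<in> Fq q"
          by (auto simp: A_le_def A_ring_iff)
        then show "(case (lead_coeff a, smult (inverse (lead_coeff a)) a) of (c, a) \<Rightarrow> smult c a) = a"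
          "(lead_coeff a, smult (inverse (lead_coeff a)) a) \<in> (Fq q - {0}) \<times> B n"
          using A_le_smult[OF F_inverse] by (auto simp: B_def A_plus_def A_le_def)
      next
        fix i :: "'c \<times> 'c poly" assume "i \<in> (Fq q - {0}) \<times> B n"
        then obtain c a where i: "i = (c, a)" "c \<in> Fq q" "c \<noteq> 0" "a \<in> A_le n" "lead_coeff a = 1"
          by (cases i) (auto simp: B_def A_plus_def)
        then have "a \<noteq> 0" "a \<in> A_ring q" by (auto simp: A_le_def)
        then show "(case i of (c, a) \<Rightarrow> smult c a) \<in> {a \<in> A_le n. ?v a \<noteq> 0}"
          "(lead_coeff (case i of (c, a) \<Rightarrow> smult c a),
            smult (inverse (lead_coeff (case i of (c, a) \<Rightarrow> smult c a))) (case i of (c, a) \<Rightarrow> smult c a)) = i"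
          "g (case i of (c, a) \<Rightarrow> smult c a) ^ l = (case i of (c, a) \<Rightarrow> g a ^ l)"
          using i A_le_smult
          by (auto simp: poly_theta_eq_0_iff g_def power_mult_distrib F_power)
      qed
      also have "\<dots> = - (b ^ l)" using b[OF that] by (simp add: g_def)
      finally have "of_nat (card (Fq q - {0 :: 'c})) * (\<Sum>a\<in>B n. g a ^ l) = - (b ^ l)"
        by (simp flip: sum.cartesian_product)
      moreover have "of_nat (card (Fq q - {0 :: 'c})) = (- 1 :: 'c)"
        using finite_F card_F of_nat_q q_ge_2 by (simp add: card_Diff_singleton of_nat_diff)
      ultimately show ?thesis by simp
    qed
    from this[of 1] this[of l] show ?thesis using l q_ge_2 by simp
  qed
  have bound: "av (g a) \<le> 1 * (max 1 (av t) / real q ^ q ^ k) ^ degree a" if "a \<in> A_plus q" for a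
  proof -
    have a: "a \<in> A_ring q" "a \<noteq> 0" using that by (auto simp: A_plus_def)
    then have "av (g a) = av (poly a t) / (real q ^ degree a) ^ q ^ k"
      by (simp add: g_def av_divide av_power av_poly_theta)
    also have "\<dots> \<le> max 1 (av t) ^ degree a / (real q ^ degree a) ^ q ^ k"
      using av_poly_le[OF a(1)] by (intro divide_right_mono) auto
    also have "\<dots> = 1 * (max 1 (av t) / real q ^ q ^ k) ^ degree a"
      by (simp add: power_divide mult.commute flip: power_mult)
    finally show ?thesis .
  qed
  have "\<exists>n. \<forall>a\<in>(\<Union>m. B m) - B n. av (g a) < \<epsilon>" if "0 < \<epsilon>" for \<epsilon>
    unfolding UB
  proof (rule small_terms[OF bound ratio_bound[OF t] _ that])
    fix n a assume "a \<in> A_plus q - B n"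
    then show "n \<le> degree a" by (auto simp: B_def A_le_def A_plus_def)
  qed
  from infsum_power[OF finB monoB this l(1) eq]
  have "(\<Sum>\<^sub>\<infinity>a\<in>A_plus q. g a ^ l) = (\<Sum>\<^sub>\<infinity>a\<in>A_plus q. g a) ^ l" unfolding UB by simp
  moreover have conv: "L_chi q \<theta> l (l * q ^ k) t = (\<Sum>\<^sub>\<infinity>a\<in>A_plus q. g a ^ l)" for l
    by (simp add: L_chi_def g_def power_divide mult.commute[of l] power_mult)
  ultimately show ?thesis using conv[of l] conv[of 1] by simp
qed

end

theorem theorem1p1:
  fixes p e q l k :: nat
    and \<theta> \<pi> z t :: "'c::{alg_closed_field,complete_space}"
  assumes "C_infinity p e q \<theta>"
    and "Carlitz_period q \<theta> \<pi>"
    and "1 \<le> l" and "l \<le> q"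
    and "z \<in> Omega q \<theta>"
    and "t \<in> B_disc (real q ^ (q ^ k))"
  shows "G_series q \<theta> \<pi> l k z t = (-1) ^ (l + 1) * G_series q \<theta> \<pi> 1 k z t ^ l"
proof -
  interpret C_infinity p e q \<theta> by fact
  show ?thesis
    \<comment> \<open>The factor 1/L for exponent l is the l-th power of the one for exponent 1.
      Should L vanish, both sides are 0 by the convention for division by zero, as l is at least
      1.\<close>
    using lattice_sum_power[OF assms(5,6,3,4), of "d1 q \<theta> \<pi> z t" "d2 q \<theta> \<pi> z t"]
      L_chi_power[OF assms(6,3,4)]
    by (simp add: G_series_def case_prod_unfold power_mult_distrib power_divide)
qed

end
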